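(* Let $\rho>0$ and consider the capital-dependent Parrondo games $A$ and $B$ with parameter $\rho$ and with bias parameter absent (i.e. equal to $0$). For every pair of positive integers $r$ and $s$ except $r=s=1$, the asymptotic mean profit per game played $\mu_{[r,s]}(0)$ of the pattern $[r,s]$ satisfies $\mu_{[r,s]}(0)>0$ for all $\rho\in(0,1)$, $\mu_{[r,s]}(0)=0$ for $\rho=1$, and $\mu_{[r,s]}(0)<0$ for all $\rho>1$. In addition, $\mu_{[1,1]}(0)=0$ for all $\rho>0$.
   Context: For $p_0,p_1,p_2\in(0,1)$ let, on state space $\Sigma=\{0,1,2\}$ (current capital modulo 3), $$\boldsymbol{P}(p_0,p_1,p_2):=\begin{pmatrix} 0 & p_0 & 1-p_0 \\ 1-p_1 & 0 & p_1 \\ p_2 & 1-p_2 & 0 \end{pmatrix},\qquad (w(i,j))_{i,j\in\Sigma}:=\begin{pmatrix} 0 & 1 & -1 \\ -1 & 0 & 1 \\ 1 & -1 & 0 \end{pmatrix},$$ where $w(i,j)$ is the payoff (profit) of a transition from $i$ to $j$. With bias parameter $0$: game $A$ has transition matrix $\boldsymbol{P}_A:=\boldsymbol{P}(\tfrac12,\tfrac12,\tfrac12)$ and game $B$ has transition matrix $\boldsymbol{P}_B:=\boldsymbol{P}(p_0,p_1,p_2)$ with $p_0:=\frac{\rho^2}{1+\rho^2}$ and $p_1=p_2:=\frac1{1+\rho}$. The pattern $[r,s]$ denotes $r$ plays of game $A$ followed by $s$ plays of game $B$, repeated ad infinitum. With $\boldsymbol{\pi}$ the unique stationary distribution of $\boldsymbol{P}_A^r\boldsymbol{P}_B^s$,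 $$\mu_{[r,s]}(0):=\frac1{r+s}\Big(\sum_{u=0}^{r-1}\sum_{i,j}(\boldsymbol{\pi}\boldsymbol{P}_A^u)_i(\boldsymbol{P}_A)_{ij}w(i,j)+\sum_{v=0}^{s-1}\sum_{i,j}(\boldsymbol{\pi}\boldsymbol{P}_A^r\boldsymbol{P}_B^v)_i(\boldsymbol{P}_B)_{ij}w(i,j)\Big).$$ *)

theory Defs
  imports "HOL-Analysis.Analysis"
begin

text \<open>
  The state space is the type \<open>3\<close>, i.e. the residues modulo 3, whose elements are
  \<open>0\<close>, \<open>1\<close>, \<open>2\<close>. The library function \<open>vector\<close> is not used to write down the
  matrices, because it fills the components \<open>1\<close>, \<open>2\<close>, \<open>3\<close> in this order and
  \<open>3 = 0\<close> in this type.
\<close>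

definition vec012 :: "'a \<Rightarrow> 'a \<Rightarrow> 'a \<Rightarrow> 'a ^ 3" where
  "vec012 a b c = (\<chi> i. if i = 0 then a else if i = 1 then b else c)"

lemma vec012_nth [simp]:
  "vec012 a b c $ 0 = a" "vec012 a b c $ 1 = b" "vec012 a b c $ 2 = c"
  by (simp_all add: vec012_def)

lemma UNIV_3_012: "(UNIV :: 3 set) = {0, 1, 2}"
proof -
  have z: "(3 :: 3) = 0" by simp
  show ?thesis
    using UNIV_3[unfolded z] by (simp only: insert_commute)
qed

lemma sum_3_012: "(\<Sum>i\<in>(UNIV :: 3 set). f i) = f 0 + f 1 + (f 2 :: 'a :: comm_monoid_add)"
proof -
  have "(0 :: 3) \<noteq> 1" "(0 :: 3) \<noteq> 2" "(1 :: 3) \<noteq> 2" by simp_all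
  then show ?thesis unfolding UNIV_3_012 by (simp add: add.assoc)
qed

definition trans_mat :: "real \<Rightarrow> real \<Rightarrow> real \<Rightarrow> real ^ 3 ^ 3" where
  "trans_mat p0 p1 p2 = vec012
     (vec012 0        p0       (1 - p0))
     (vec012 (1 - p1) 0        p1)
     (vec012 p2       (1 - p2) 0)"

definition payoff :: "real ^ 3 ^ 3" where
  "payoff = vec012
     (vec012 0    1    (-1))
     (vec012 (-1) 0    1)
     (vec012 1    (-1) 0)"

definition game_A :: "real ^ 3 ^ 3" where
  "game_A = trans_mat (1/2) (1/2) (1/2)"

definition game_B :: "real \<Rightarrow> real ^ 3 ^ 3" where
  "game_B \<rho> = trans_mat (\<rho>\<^sup>2 / (1 + \<rho>\<^sup>2)) (1 / (1 + \<rho>)) (1 / (1 + \<rho>))"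

text \<open>
  Powers with respect to the matrix product \<open>**\<close>; the operations \<open>*\<close> and \<open>^\<close> of the
  type of vectors are componentwise.
\<close>

primrec mat_pow :: "real ^ 'n ^ 'n \<Rightarrow> nat \<Rightarrow> real ^ 'n ^ 'n" where
  "mat_pow M 0 = mat 1"
| "mat_pow M (Suc n) = M ** mat_pow M n"

definition is_stationary_distribution :: "real ^ 'n \<Rightarrow> real ^ 'n ^ 'n \<Rightarrow> bool" where
  "is_stationary_distribution \<pi> M \<longleftrightarrow>
     (\<forall>i. \<pi> $ i \<ge> 0) \<and> (\<Sum>i\<in>UNIV. \<pi> $ i) = 1 \<and> \<pi> v* M = \<pi>"

definition stationary_distribution :: "real ^ 'n ^ 'n \<Rightarrow> real ^ 'n" where
  "stationary_distribution M = (THE \<pi>. is_stationary_distribution \<pi> M)"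

text \<open>Expected payoff of one play with transition matrix \<open>M\<close> from the distribution \<open>\<nu>\<close>.\<close>

definition expected_payoff :: "real ^ 3 \<Rightarrow> real ^ 3 ^ 3 \<Rightarrow> real" where
  "expected_payoff \<nu> M = (\<Sum>i\<in>UNIV. \<Sum>j\<in>UNIV. \<nu> $ i * M $ i $ j * payoff $ i $ j)"

definition mean_profit :: "real \<Rightarrow> nat \<Rightarrow> nat \<Rightarrow> real" where
  "mean_profit \<rho> r s =
     (let A = game_A; B = game_B \<rho>;
          \<pi> = stationary_distribution (mat_pow A r ** mat_pow B s)
      in 1 / real (r + s) *
           ((\<Sum>u<r. expected_payoff (\<pi> v* mat_pow A u) A) +
            (\<Sum>v<s. expected_payoff (\<pi> v* (mat_pow A r ** mat_pow B v)) B)))"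

end

theory Submission
  imports Defs
begin

text \<open>
  Game \<open>A\<close> contracts distributions towards the uniform one by the factor \<open>-1/2\<close>, and its plays
  have mean profit zero. The one-step drift \<open>h\<close> of game \<open>B\<close> satisfies \<open>B\<^sup>2h + Bh + Dh = 0\<close> with
  \<open>0 < D < 1/4\<close> for \<open>\<rho> \<noteq> 1\<close>, so it splits into two eigenvectors with eigenvalues \<open>-y\<close> and \<open>-z\<close>, where
  \<open>y + z = 1\<close> and \<open>yz = D\<close>. Since \<open>h\<close> and \<open>Bh\<close> have the same mean under the uniform distribution, the
  mean profit is a positive multiple of \<open>(1 - \<rho>)\<^sup>3 (F y - F z)\<close> for
  \<open>F t = (1 - (-t)\<^sup>s) / ((1 - a (-t)\<^sup>s) (1 + t)\<^sup>2)\<close>, \<open>a = (-1/2)\<^sup>r\<close>. That difference is positive unless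
  \<open>r = s = 1\<close>, when \<open>F\<close> is symmetric about \<open>1/2\<close>.
\<close>

lemma forall_3_012: "(\<forall>i::3. P i) \<longleftrightarrow> P 0 \<and> P 1 \<and> P 2"
proof -
  have "(\<forall>i. P i) \<longleftrightarrow> (\<forall>i\<in>UNIV. P i)" by simp
  then show ?thesis by (simp only: UNIV_3_012) auto
qed

lemma vec3_eq_iff: "(x :: 'a ^ 3) = y \<longleftrightarrow> x $ 0 = y $ 0 \<and> x $ 1 = y $ 1 \<and> x $ 2 = y $ 2"
  by (simp add: vec_eq_iff forall_3_012)

subsection \<open>Stationary distributions\<close>

definition stochastic :: "real ^ 'n ^ 'n \<Rightarrow> bool" where
  "stochastic M \<longleftrightarrow> (\<forall>i j. 0 \<le> M $ i $ j) \<and> (\<forall>i. (\<Sum>j\<in>UNIV. M $ i $ j) = 1)"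

lemma vector_matrix_mult_nth: "(x v* M) $ j = (\<Sum>i\<in>UNIV. x $ i * (M :: real ^ 'n ^ 'm) $ i $ j)"
  by (simp add: vector_matrix_mult_def mult.commute)

lemma sum_vector_stochastic:
  assumes "stochastic M"
  shows "(\<Sum>j\<in>UNIV. (x v* M) $ j) = (\<Sum>i\<in>UNIV. x $ i)"
proof -
  have "(\<Sum>j\<in>UNIV. (x v* M) $ j) = (\<Sum>i\<in>UNIV. \<Sum>j\<in>UNIV. x $ i * M $ i $ j)"
    unfolding vector_matrix_mult_nth by (rule sum.swap)
  also have "\<dots> = (\<Sum>i\<in>UNIV. x $ i)"
    using assms by (simp add: stochastic_def flip: sum_distrib_left)
  finally show ?thesis .
qed

text \<open>Triangle inequality, then row sums 1: a stochastic matrix does not expand the l1 norm.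
  This gives the uniqueness of the stationary distribution.\<close>

lemma sum_abs_vector_stochastic:
  assumes "stochastic M"
  shows "(\<Sum>j\<in>UNIV. \<bar>(x v* M) $ j\<bar>) \<le> (\<Sum>i\<in>UNIV. \<bar>x $ i\<bar>)"
proof -
  have "(\<Sum>j\<in>UNIV. \<bar>(x v* M) $ j\<bar>) \<le> (\<Sum>j\<in>UNIV. \<Sum>i\<in>UNIV. \<bar>x $ i * M $ i $ j\<bar>)"
    unfolding vector_matrix_mult_nth by (intro sum_mono sum_abs)
  also have "\<dots> = (\<Sum>i\<in>UNIV. \<Sum>j\<in>UNIV. \<bar>x $ i\<bar> * M $ i $ j)"
    using assms by (subst sum.swap) (simp add: stochastic_def abs_mult)
  also have "\<dots> = (\<Sum>i\<in>UNIV. \<bar>x $ i\<bar>)"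
    using assms by (simp add: stochastic_def flip: sum_distrib_left)
  finally show ?thesis .
qed

lemma stochastic_mult:
  assumes "stochastic M" "stochastic N"
  shows "stochastic (M ** N)"
  unfolding stochastic_def
proof safe
  fix i j
  show "0 \<le> (M ** N) $ i $ j"
    using assms by (auto simp: stochastic_def matrix_matrix_mult_def intro!: sum_nonneg)
next
  fix i
  have "(\<Sum>j\<in>UNIV. (M ** N) $ i $ j) = (\<Sum>k\<in>UNIV. \<Sum>j\<in>UNIV. M $ i $ k * N $ k $ j)"
    unfolding matrix_matrix_mult_def by (simp, rule sum.swap)
  also have "\<dots> = 1"
    using assms by (simp add: stochastic_def flip: sum_distrib_left)
  finally show "(\<Sum>j\<in>UNIV. (M ** N) $ i $ j) = 1" .
qed

lemma stochastic_mat_pow: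
  assumes "stochastic M"
  shows "stochastic (mat_pow M n)"
proof (induction n)
  case 0
  then show ?case by (simp add: stochastic_def mat_def)
next
  case (Suc n)
  then show ?case using assms by (simp add: stochastic_mult)
qed

text \<open>Brouwer's theorem on the probability simplex \<open>S\<close>, which is compact, convex,
  nonempty and mapped into itself.\<close>

lemma stationary_distribution_exists:
  fixes M :: "real ^ 'n ^ 'n"
  assumes "stochastic M"
  shows "\<exists>\<pi>. is_stationary_distribution \<pi> M"
proof -
  define S :: "(real ^ 'n) set" where "S = {x. (\<forall>i. 0 \<le> x $ i) \<and> (\<Sum>i\<in>UNIV. x $ i) = 1}"
  have le1: "x $ i \<le> 1" if "x \<in> S" for x i
    using that member_le_sum[of i UNIV "\<lambda>i. x $ i"] by (auto simp: S_def)
  have "bounded S"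
  proof (rule boundedI)
    fix x assume x: "x \<in> S"
    have "norm x \<le> (\<Sum>i\<in>UNIV. \<bar>x $ i\<bar>)" by (rule norm_le_l1_cart)
    also have "\<dots> = 1" using x by (simp add: S_def)
    finally show "norm x \<le> 1" .
  qed
  moreover have "closed S"
    unfolding S_def
    by (intro closed_Collect_conj closed_Collect_all closed_Collect_le closed_Collect_eq
        continuous_intros)
  ultimately have "compact S" by (simp add: compact_eq_bounded_closed)
  moreover have "convex S"
    by (rule convexI) (auto simp: S_def sum.distrib simp flip: sum_distrib_left)
  moreover have "axis undefined 1 \<in> S"
    by (auto simp: S_def axis_def)
  then have "S \<noteq> {}" by blast
  moreover have "continuous_on S (\<lambda>x. x v* M)"
    unfolding vector_matrix_mult_def by (intro continuous_intros)
  moreover have "(\<lambda>x. x v* M) ` S \<subseteq> S"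
    using assms sum_vector_stochastic[OF assms]
    by (auto simp: S_def) (auto simp: vector_matrix_mult_nth stochastic_def intro!: sum_nonneg)
  ultimately obtain x where "x \<in> S" "x v* M = x"
    using brouwer by (metis image_subset_iff_funcset)
  then show ?thesis by (auto simp: S_def is_stationary_distribution_def)
qed

subsection \<open>The games\<close>

lemma stochastic_trans_mat:
  assumes "0 \<le> p0" "p0 \<le> 1" "0 \<le> p1" "p1 \<le> 1" "0 \<le> p2" "p2 \<le> 1"
  shows "stochastic (trans_mat p0 p1 p2)"
  using assms by (simp add: stochastic_def trans_mat_def forall_3_012 sum_3_012)

lemma stochastic_game_A: "stochastic game_A"
  unfolding game_A_def by (rule stochastic_trans_mat) auto

lemma stochastic_game_B:
  assumes "0 < \<rho>"
  shows "stochastic (game_B \<rho>)"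
  unfolding game_B_def
  by (rule stochastic_trans_mat)
    (use assms in \<open>auto simp: divide_simps add_nonneg_pos intro: add_nonneg_nonneg\<close>)

text \<open>\<open>game_A\<close> is half of (all-ones matrix minus identity), so it fixes the
  uniform vector and acts as -1/2 on vectors of sum zero. The vector \<open>x\<close> is arbitrary
  because the formula is also applied to differences of distributions.\<close>

lemma vector_game_A_pow:
  "(x v* mat_pow game_A r) $ i =
     (-1/2) ^ r * x $ i + (1 - (-1/2) ^ r) / 3 * (\<Sum>j\<in>UNIV. x $ j)"
proof (induction r arbitrary: x)
  case 0
  then show ?case by simp
next
  case (Suc r)
  have *: "\<forall>i. (x v* game_A) $ i = ((\<Sum>j\<in>UNIV. x $ j) - x $ i) / 2"
    by (simp add: forall_3_012 vector_matrix_mult_nth sum_3_012 game_A_def trans_mat_def field_simps)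
  show ?case
    by (simp add: vector_matrix_mul_assoc[symmetric] Suc sum_vector_stochastic[OF stochastic_game_A])
      (simp add: * field_simps)
qed

text \<open>Makes the definite description usable. The difference \<open>d\<close> of two stationary
  distributions has sum zero, so the plays of game A shrink its l1 norm by
  \<open>(1/2) ^ r < 1\<close>, while those of game B do not expand it; hence \<open>d\<close>
  vanishes.\<close>

lemma stationary_distribution_games:
  fixes s :: nat
  assumes "0 < \<rho>" "0 < r"
  defines "M \<equiv> mat_pow game_A r ** mat_pow (game_B \<rho>) s"
  shows "is_stationary_distribution (stationary_distribution M) M"
  unfolding stationary_distribution_def
proof (rule theI')
  have stB: "stochastic (mat_pow (game_B \<rho>) s)"
    using assms(1) by (intro stochastic_mat_pow stochastic_game_B)
  have "stochastic M"
    unfolding M_def by (intro stochastic_mult stochastic_mat_pow stochastic_game_A stB)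
  then obtain \<pi> where \<pi>: "is_stationary_distribution \<pi> M"
    using stationary_distribution_exists by blast
  show "\<exists>!\<pi>. is_stationary_distribution \<pi> M"
  proof (rule ex1I[where a = \<pi>])
    show "is_stationary_distribution \<pi> M" by (rule \<pi>)
  next
    fix \<pi>' assume \<pi>': "is_stationary_distribution \<pi>' M"
    define d where "d = \<pi>' - \<pi>"
    have d0: "(\<Sum>i\<in>UNIV. d $ i) = 0"
      using \<pi> \<pi>' by (simp add: d_def is_stationary_distribution_def sum_subtractf)
    have dM: "d v* M = d"
      using \<pi> \<pi>' by (simp add: d_def is_stationary_distribution_def vec_eq_iff
          vector_matrix_mult_nth left_diff_distrib sum_subtractf)
    have "(\<Sum>i\<in>UNIV. \<bar>d $ i\<bar>) = (\<Sum>i\<in>UNIV. \<bar>((d v* mat_pow game_A r) v* mat_pow (game_B \<rho>) s) $ i\<bar>)"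
      using dM by (simp add: M_def vector_matrix_mul_assoc[symmetric])
    also have "\<dots> \<le> (\<Sum>i\<in>UNIV. \<bar>(d v* mat_pow game_A r) $ i\<bar>)"
      by (rule sum_abs_vector_stochastic[OF stB])
    also have "\<dots> = (1/2) ^ r * (\<Sum>i\<in>UNIV. \<bar>d $ i\<bar>)"
      by (simp add: vector_game_A_pow d0 abs_mult power_abs sum_distrib_left)
    finally have "(1 - (1/2) ^ r) * (\<Sum>i\<in>UNIV. \<bar>d $ i\<bar>) \<le> 0"
      by (simp add: algebra_simps)
    moreover have "(1/2 :: real) ^ r < 1" using assms(2) by (simp add: power_less_one_iff)
    ultimately have "(\<Sum>i\<in>UNIV. \<bar>d $ i\<bar>) \<le> 0" by (simp add: mult_le_0_iff)
    then have "(\<Sum>i\<in>UNIV. \<bar>d $ i\<bar>) = 0" by (simp add: sum_nonneg antisym)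
    then have "\<forall>i. d $ i = 0" by (simp add: sum_nonneg_eq_0_iff)
    then show "\<pi>' = \<pi>" by (simp add: d_def vec_eq_iff)
  qed
qed

text \<open>Component i is 2 p_i - 1, the expected payoff of one play of game B from state
  i.\<close>

definition drift :: "real \<Rightarrow> real ^ 3" where
  "drift \<rho> = vec012 ((\<rho>\<^sup>2 - 1) / (\<rho>\<^sup>2 + 1)) ((1 - \<rho>) / (1 + \<rho>)) ((1 - \<rho>) / (1 + \<rho>))"

lemma expected_payoff_game_A: "expected_payoff \<nu> game_A = 0"
  by (simp add: expected_payoff_def sum_3_012 game_A_def trans_mat_def payoff_def)

lemma expected_payoff_game_B:
  assumes "0 < \<rho>"
  shows "expected_payoff \<nu> (game_B \<rho>) = \<nu> \<bullet> drift \<rho>"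
proof -
  have "1 + \<rho>\<^sup>2 > 0" by (simp add: add_pos_nonneg)
  then have "(\<rho>\<^sup>2 - 1) / (\<rho>\<^sup>2 + 1) = 2 * (\<rho>\<^sup>2 / (1 + \<rho>\<^sup>2)) - 1"
    "(1 - \<rho>) / (1 + \<rho>) = 2 * (1 / (1 + \<rho>)) - 1"
    using assms by (simp_all add: field_simps)
  then show ?thesis
    unfolding drift_def game_B_def
    by (simp add: expected_payoff_def sum_3_012 trans_mat_def payoff_def inner_vec_def)
      (simp add: algebra_simps)
qed

text \<open>The coefficient D is the determinant of \<open>game_B\<close>, whose characteristic
  polynomial is (x - 1)(x^2 + x + D). The quadratic factor sends the drift to a constant vector,
  which is zero because game B alone is fair. The proof verifies this by components.\<close>

lemma game_B_drift_quadratic: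
  assumes "0 < \<rho>"
  shows "game_B \<rho> *v (game_B \<rho> *v drift \<rho>) =
     - (game_B \<rho> *v drift \<rho>) - (2 * \<rho>\<^sup>2 / ((1 + \<rho>\<^sup>2) * (1 + \<rho>)\<^sup>2)) *\<^sub>R drift \<rho>"
proof -
  have "1 + \<rho>\<^sup>2 \<noteq> 0" "\<rho>\<^sup>2 + 1 \<noteq> 0" "1 + \<rho> \<noteq> 0"
    using assms by (simp_all add: add_nonneg_eq_0_iff)
  then show ?thesis
    by (simp add: vec3_eq_iff matrix_vector_mult_def sum_3_012 game_B_def trans_mat_def drift_def)
      (simp add: divide_simps; simp add: algebra_simps power2_eq_square)
qed

text \<open>Source of the factor \<open>(1 - \<rho>) ^ 3\<close>, which alone decides the sign of
  the profit.\<close>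

lemma sum_drift:
  assumes "0 < \<rho>"
  shows "(\<Sum>i\<in>UNIV. drift \<rho> $ i) = (1 - \<rho>) ^ 3 / ((1 + \<rho>) * (1 + \<rho>\<^sup>2))"
proof -
  have "1 + \<rho>\<^sup>2 \<noteq> 0" "\<rho>\<^sup>2 + 1 \<noteq> 0" "1 + \<rho> \<noteq> 0"
    using assms by (simp_all add: add_nonneg_eq_0_iff)
  then show ?thesis
    by (simp add: sum_3_012 drift_def)
      (simp add: divide_simps; simp add: algebra_simps power2_eq_square power3_eq_cube)
qed

text \<open>Since p_1 = p_2, the columns of \<open>game_B\<close> sum to 1, 1 + e and 1 - e for some
  e, and the drift is the same in states 1 and 2, so e cancels.\<close>

lemma sum_game_B_drift:
  assumes "0 < \<rho>"
  shows "(\<Sum>i\<in>UNIV. (game_B \<rho> *v drift \<rho>) $ i) = (\<Sum>i\<in>UNIV. drift \<rho> $ i)"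
proof -
  have "1 + \<rho>\<^sup>2 \<noteq> 0" "\<rho>\<^sup>2 + 1 \<noteq> 0" "1 + \<rho> \<noteq> 0"
    using assms by (simp_all add: add_nonneg_eq_0_iff)
  then show ?thesis
    by (simp add: sum_3_012 matrix_vector_mult_def game_B_def trans_mat_def drift_def)
      (simp add: divide_simps; simp add: algebra_simps power2_eq_square)
qed

lemma mat_pow_eigenvector:
  assumes "M *v f = c *\<^sub>R f"
  shows "mat_pow M n *v f = c ^ n *\<^sub>R f"
  by (induction n) (simp_all add: assms matrix_vector_mult_scaleR flip: matrix_vector_mul_assoc)

subsection \<open>The profit formula\<close>

text \<open>Contribution of the eigenvalue \<open>-t\<close>, up to a factor symmetric in the two
  eigenvalues and a sign.\<close>

definition profit_kernel :: "real \<Rightarrow> nat \<Rightarrow> real \<Rightarrow> real" where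
  "profit_kernel a s t = (1 - (-t) ^ s) / ((1 - a * (-t) ^ s) * (1 + t)\<^sup>2)"

lemma mean_profit_formula:
  assumes \<rho>: "0 < \<rho>" and r: "0 < r"
    and yz: "y + z = 1" "y * z = 2 * \<rho>\<^sup>2 / ((1 + \<rho>\<^sup>2) * (1 + \<rho>)\<^sup>2)" "0 < y" "y < z"
  defines "a \<equiv> (-1/2) ^ r"
  shows "mean_profit \<rho> r s = (1 - \<rho>) ^ 3 *
     ((1 - a) * (1 + y) * (1 + z) / (3 * real (r + s) * ((1 + \<rho>) * (1 + \<rho>\<^sup>2)) * (z - y))
       * (profit_kernel a s y - profit_kernel a s z))"
proof -
  define A where "A = game_A"
  define B where "B = game_B \<rho>"
  define h where "h = drift \<rho>"
  define C where "C = (1 - \<rho>) ^ 3 / ((1 + \<rho>) * (1 + \<rho>\<^sup>2))"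
  define \<pi> where "\<pi> = stationary_distribution (mat_pow A r ** mat_pow B s)"
  define \<nu> where "\<nu> = \<pi> v* mat_pow A r"
  define f where "f t = B *v h + t *\<^sub>R h" for t
  have st: "is_stationary_distribution \<pi> (mat_pow A r ** mat_pow B s)"
    unfolding \<pi>_def A_def B_def by (rule stationary_distribution_games[OF \<rho> r])
  then have \<pi>: "(\<Sum>i\<in>UNIV. \<pi> $ i) = 1" "\<nu> v* mat_pow B s = \<pi>"
    by (simp_all add: is_stationary_distribution_def \<nu>_def vector_matrix_mul_assoc[symmetric])
  have \<nu>: "\<nu> = a *\<^sub>R \<pi> + (\<chi> i. (1 - a) / 3)"
    by (simp add: vec_eq_iff \<nu>_def A_def vector_game_A_pow \<pi> a_def)
  have a: "\<bar>a\<bar> \<le> 1/2"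
    using r power_decreasing[of 1 r "1/2::real"] by (simp add: a_def power_abs)
  have quad: "B *v (B *v h) = - (B *v h) - (y * z) *\<^sub>R h"
    unfolding B_def h_def yz(2) by (rule game_B_drift_quadratic[OF \<rho>])
  \<comment> \<open>Here \<open>t\<close> and \<open>t'\<close> are the roots \<open>y\<close> and
    \<open>z\<close> in either order; the eigenvalue of \<open>f t\<close> is minus the other
    root.\<close>
  have eig: "B *v f t = (-t') *\<^sub>R f t" if "t + t' = 1" "t * t' = y * z" for t t'
  proof -
    have "B *v f t = (t - 1) *\<^sub>R (B *v h) - (t * t') *\<^sub>R h"
      unfolding f_def that(2)
      by (simp add: matrix_vector_right_distrib matrix_vector_mult_scaleR quad)
        (simp add: algebra_simps)
    also have "t - 1 = -t'" using that(1) by simp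
    finally show ?thesis by (simp add: f_def algebra_simps)
  qed
  have sumf: "(\<Sum>i\<in>UNIV. f t $ i) = (1 + t) * C" for t
  proof -
    have "(\<Sum>i\<in>UNIV. h $ i) = C" "(\<Sum>i\<in>UNIV. (B *v h) $ i) = C"
      using sum_game_B_drift[OF \<rho>] sum_drift[OF \<rho>] by (simp_all add: B_def h_def C_def)
    then show ?thesis
      by (simp add: f_def sum.distrib distrib_right flip: sum_distrib_left)
  qed
  \<comment> \<open>Going once around the pattern expresses the unknown
    \<open>\<nu> \<bullet> f t\<close> affinely in itself: \<open>\<nu>\<close> is \<open>a\<close>
    times \<open>\<pi>\<close> plus a uniform part, and \<open>\<pi>\<close> is \<open>\<nu>\<close>
    after \<open>s\<close> plays of B, which multiply by \<open>(-t') ^ s\<close>.\<close>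
  have \<nu>f: "\<nu> \<bullet> f t = (1 - a) / 3 * (1 + t) * C / (1 - a * (-t') ^ s)"
    if t: "t + t' = 1" "t * t' = y * z" "0 \<le> t'" "t' \<le> 1" for t t'
  proof -
    have "\<nu> \<bullet> f t = a * (\<pi> \<bullet> f t) + (1 - a) / 3 * (\<Sum>i\<in>UNIV. f t $ i)"
      by (subst \<nu>) (simp add: inner_add_left inner_vec_def[of "\<chi> i. _ i"] sum_distrib_left)
    also have "\<pi> \<bullet> f t = \<nu> \<bullet> (mat_pow B s *v f t)"
      using \<pi>(2) by (metis dot_lmul_matrix)
    also have "\<dots> = (-t') ^ s * (\<nu> \<bullet> f t)"
      by (simp add: mat_pow_eigenvector[OF eig[OF t(1,2)]])
    finally have *: "(1 - a * (-t') ^ s) * (\<nu> \<bullet> f t) = (1 - a) / 3 * (1 + t) * C"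
      by (simp add: sumf field_simps)
    have "\<bar>a * (-t') ^ s\<bar> \<le> 1/2 * 1"
      unfolding abs_mult using a t by (intro mult_mono) (auto simp: power_abs power_le_one)
    then have "1 - a * (-t') ^ s \<noteq> 0" by linarith
    with * show ?thesis by (simp add: field_simps)
  qed
  have h: "h = (1 / (z - y)) *\<^sub>R (f z - f y)"
    using yz by (simp add: f_def algebra_simps flip: scaleR_left_diff_distrib)
  have geo: "(\<Sum>v<s. \<nu> \<bullet> (mat_pow B v *v f t)) = (1 - (-t') ^ s) / (1 + t') * (\<nu> \<bullet> f t)"
    if t: "t + t' = 1" "t * t' = y * z" "0 \<le> t'" for t t'
  proof -
    have "(\<Sum>v<s. \<nu> \<bullet> (mat_pow B v *v f t)) = (\<Sum>v<s. (-t') ^ v) * (\<nu> \<bullet> f t)"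
      by (simp add: mat_pow_eigenvector[OF eig[OF t(1,2)]] sum_distrib_right)
    also have "(\<Sum>v<s. (-t') ^ v) = (1 - (-t') ^ s) / (1 + t')"
      using t by (simp add: sum_gp_strict)
    finally show ?thesis .
  qed
  have prod: "(\<Sum>v<s. \<nu> \<bullet> (mat_pow B v *v f t)) =
      (1 - a) * (1 + t') * (1 + t) / 3 * C * profit_kernel a s t'"
    if t: "t + t' = 1" "t * t' = y * z" "0 \<le> t'" "t' \<le> 1" for t t'
  proof -
    \<comment> \<open>Expanding by \<open>x = 1 + t'\<close> makes the prefactor symmetric in
      \<open>t\<close> and \<open>t'\<close>; hence the square in the kernel.\<close>
    have *: "e / x * (b / 3 * w * C / k) = b * x * w / 3 * C * (e / (k * x\<^sup>2))"
      if "x \<noteq> 0" for e x b w k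
      using that by (simp add: divide_simps power2_eq_square)
    show ?thesis
      unfolding geo[OF t(1-3)] \<nu>f[OF t] profit_kernel_def by (rule *) (use t in simp)
  qed
  have "mean_profit \<rho> r s = 1 / real (r + s) *
      (\<Sum>v<s. expected_payoff (\<pi> v* (mat_pow A r ** mat_pow B v)) B)"
    by (simp add: mean_profit_def Let_def expected_payoff_game_A \<pi>_def A_def B_def)
  also have "(\<Sum>v<s. expected_payoff (\<pi> v* (mat_pow A r ** mat_pow B v)) B) =
      (\<Sum>v<s. \<nu> \<bullet> (mat_pow B v *v h))"
    by (simp add: B_def expected_payoff_game_B[OF \<rho>] vector_matrix_mul_assoc[symmetric] \<nu>_def h_def dot_lmul_matrix)
  also have "\<dots> = 1 / (z - y) * ((\<Sum>v<s. \<nu> \<bullet> (mat_pow B v *v f z)) - (\<Sum>v<s. \<nu> \<bullet> (mat_pow B v *v f y)))"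
    by (subst h) (simp add: matrix_vector_mult_scaleR matrix_vector_mult_diff_distrib inner_diff_right
        sum_subtractf diff_divide_distrib flip: sum_divide_distrib)
  also have "(\<Sum>v<s. \<nu> \<bullet> (mat_pow B v *v f z)) =
      (1 - a) * (1 + y) * (1 + z) / 3 * C * profit_kernel a s y"
    by (rule prod) (use yz in \<open>auto simp: mult.commute\<close>)
  also have "(\<Sum>v<s. \<nu> \<bullet> (mat_pow B v *v f y)) =
      (1 - a) * (1 + z) * (1 + y) / 3 * C * profit_kernel a s z"
    by (rule prod) (use yz in \<open>auto simp: mult.commute\<close>)
  also have "1 / R * (1 / e * (b * v * w / 3 * C * P - b * w * v / 3 * C * Q))
      = (1 - \<rho>) ^ 3 * (b * v * w / (3 * R * ((1 + \<rho>) * (1 + \<rho>\<^sup>2)) * e) * (P - Q))"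
    for R e b v w P Q :: real
    \<comment> \<open>If a denominator vanishes, both sides are 0 by
      \<open>x / 0 = 0\<close>.\<close>
    unfolding C_def by (cases "R = 0 \<or> e = 0 \<or> 1 + \<rho> = 0 \<or> 1 + \<rho>\<^sup>2 = 0")
      (auto simp: divide_simps right_diff_distrib)
  finally show ?thesis .
qed

section \<open>Comparison of the kernel at the two eigenvalues\<close>

lemma power_diff_recurrence:
  fixes y z :: real
  assumes "y + z = 1"
  shows "z ^ Suc (Suc n) - y ^ Suc (Suc n) = (z ^ Suc n - y ^ Suc n) - y * z * (z ^ n - y ^ n)"
proof -
  have y: "y = 1 - z" using assms by simp
  show ?thesis unfolding y by (simp add: algebra_simps)
qed

text \<open>As \<open>y\<close> and \<open>z\<close> are the roots of x^2 = x - yz, each step of the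
  recurrence subtracts a nonnegative term. Exponents start at 1, because at exponent 0 the
  difference is 0.\<close>

lemma power_diff_antimono:
  fixes y z :: real
  assumes "y + z = 1" "0 \<le> y" "y \<le> z" "m \<le> n"
  shows "z ^ Suc n - y ^ Suc n \<le> z ^ Suc m - y ^ Suc m"
  using assms(4)
proof (rule lift_Suc_antimono_le[where f = "\<lambda>n. z ^ Suc n - y ^ Suc n", rotated])
  fix n
  have "0 \<le> y * z * (z ^ n - y ^ n)" using assms by (simp add: power_mono)
  then show "z ^ Suc (Suc n) - y ^ Suc (Suc n) \<le> z ^ Suc n - y ^ Suc n"
    by (subst power_diff_recurrence[OF assms(1)]) linarith
qed

text \<open>
  For odd \<open>s\<close>, the inequality between the values of the kernel, cleared of denominators, is affine
  in \<open>a\<close> with positive slope, so the worst case is \<open>a = -1/2\<close>.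
\<close>

lemma odd_extremal:
  fixes y z :: real
  assumes yz: "y + z = 1" "0 < y" "y < z"
  shows "(1 + z ^ (k + 3)) * (2 - y ^ (k + 3)) * (1 + y)\<^sup>2
    < (1 + y ^ (k + 3)) * (2 - z ^ (k + 3)) * (1 + z)\<^sup>2"
proof -
  define d where "d n = z ^ n - y ^ n" for n
  define m where "m = y * z"
  have z: "z = 1 - y" using yz by simp
  have m: "0 < m" "m < 1" using yz mult_strict_mono[of y 1 z 1] by (auto simp: m_def)
  \<comment> \<open>The left side changes sign when \<open>y\<close> and \<open>z\<close> are
    swapped, so it can be written through the differences \<open>d n\<close> and the product
    \<open>m\<close>.\<close>
  have E: "(1 + y ^ (k + 3)) * (2 - z ^ (k + 3)) * (1 + z)\<^sup>2
      - (1 + z ^ (k + 3)) * (2 - y ^ (k + 3)) * (1 + y)\<^sup>2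
      = 3 * ((d 1 - d (k + 3)) + (d 1 - d (k + 3)) - (m ^ (k + 3) * d 1 + m\<^sup>2 * d (k + 1)))"
    unfolding d_def m_def z
    by (simp add: power_mult_distrib)
      (simp add: algebra_simps power2_eq_square power3_eq_cube power_add)
  \<comment> \<open>From \<open>d (k + 3) \<le> d 3 = (1 - m) * d 1\<close>, each gap
    \<open>d 1 - d (k + 3)\<close> is at least \<open>m * d 1\<close>; each of the two subtracted
    terms is at most m^2 times \<open>d 1\<close>, which is smaller.\<close>
  have "d (k + 3) \<le> d 3" "d (k + 1) \<le> d 1"
    using power_diff_antimono[of y z 2 "k + 2"] power_diff_antimono[of y z 0 k] yz
    by (simp_all add: d_def eval_nat_numeral)
  moreover have "d 3 = d 1 - m * d 1"
    by (simp add: d_def m_def z algebra_simps power3_eq_cube)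
  moreover have d1: "0 < d 1" using yz by (simp add: d_def)
  moreover have "m ^ (k + 3) \<le> m\<^sup>2" using m by (intro power_decreasing) auto
  then have "m ^ (k + 3) * d 1 \<le> m\<^sup>2 * d 1" by (rule mult_right_mono) (use d1 in simp)
  moreover have "m\<^sup>2 * d (k + 1) \<le> m\<^sup>2 * d 1" using calculation(2) by (simp add: mult_left_mono)
  moreover have "m\<^sup>2 * d 1 < m * d 1"
    by (rule mult_strict_right_mono) (use m d1 in \<open>simp_all add: power2_eq_square\<close>)
  ultimately have "d (k + 3) \<le> d 1 - m * d 1" "m ^ (k + 3) * d 1 < m * d 1"
    "m\<^sup>2 * d (k + 1) < m * d 1"
    by (metis le_less_trans)+
  then have "m ^ (k + 3) * d 1 < d 1 - d (k + 3)" "m\<^sup>2 * d (k + 1) < d 1 - d (k + 3)"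
    by linarith+
  from add_strict_mono[OF this] show ?thesis
    by (subst diff_gt_0_iff_gt[symmetric], subst E) simp
qed

lemma divide_less_cross:
  fixes a b c d :: real
  assumes "0 < b" "0 < d" "a * d < c * b"
  shows "a / b < c / d"
  using assms by (simp add: divide_simps)

lemma profit_kernel_less:
  fixes y z :: real
  assumes yz: "y + z = 1" "0 < y" "y < z" and rs: "0 < r" "0 < s" "\<not> (r = 1 \<and> s = 1)"
  defines "a \<equiv> (-1/2) ^ r"
  shows "profit_kernel a s z < profit_kernel a s y"
proof -
  define Y Z where "Y = y ^ s" and "Z = z ^ s"
  have YZ: "0 < Y" "Y < Z" "Z < 1"
    using yz rs by (auto simp: Y_def Z_def power_strict_mono power_less_one_iff)
  have a: "\<bar>a\<bar> \<le> 1/2"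
    using rs power_decreasing[of 1 r "1/2::real"] by (simp add: a_def power_abs)
  have sq: "(1 + y)\<^sup>2 < (1 + z)\<^sup>2" "0 < (1 + y)\<^sup>2" using yz by (auto intro: power_strict_mono)
  have aY: "\<bar>a * Y\<bar> \<le> 1/2 * 1" and aZ: "\<bar>a * Z\<bar> \<le> 1/2 * 1"
    unfolding abs_mult by (rule mult_mono; use a YZ in simp)+
  show ?thesis
  proof (cases "even s")
    case True
    \<comment> \<open>For even \<open>s\<close> the quotient (1 - x)/(1 - a x) already decreases
      from \<open>Y\<close> to \<open>Z\<close>, and the square in the denominator helps.\<close>
    have "(1 - Y) * (1 - a * Z) - (1 - Z) * (1 - a * Y) = (1 - a) * (Z - Y)"
      by (simp add: algebra_simps)
    moreover have "0 < (1 - a) * (Z - Y)" using a YZ by simp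
    ultimately have "(1 - Z) * (1 - a * Y) < (1 - Y) * (1 - a * Z)" by linarith
    then have "(1 - Z) * (1 - a * Y) * (1 + y)\<^sup>2 < (1 - Y) * (1 - a * Z) * (1 + z)\<^sup>2"
      by (rule mult_strict_mono) (use sq YZ aY aZ in \<open>auto intro!: mult_pos_pos\<close>)
    moreover have "0 < (1 - a * Y) * (1 + y)\<^sup>2" "0 < (1 - a * Z) * (1 + z)\<^sup>2"
      using sq aY aZ by (auto intro!: mult_pos_pos)
    ultimately show ?thesis
      unfolding profit_kernel_def using True
      by (simp add: divide_less_cross mult.assoc flip: Y_def Z_def)
  next
    case False
    define p q where "p = (1 + z)\<^sup>2" and "q = (1 + y)\<^sup>2"
    \<comment> \<open>\<open>L / 2\<close> is the cleared inequality's difference at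
      \<open>a = -1/2\<close>, and \<open>coef\<close> says that its slope in \<open>a\<close> is
      positive.\<close>
    define L where "L = (1 + Y) * (2 - Z) * p - (1 + Z) * (2 - Y) * q"
    have coef: "0 < Z * (1 + Y) * p - Y * (1 + Z) * q"
    proof -
      have "Y * (1 + Z) * q < Z * (1 + Y) * p"
      proof (rule mult_strict_mono)
        show "Y * (1 + Z) < Z * (1 + Y)" "q < p" "0 < Z * (1 + Y)" "0 \<le> q"
          using YZ sq by (simp_all add: p_def q_def add_pos_pos distrib_left mult.commute)
      qed
      then show ?thesis by simp
    qed
    have pos: "0 < L / 2 + (a + 1/2) * (Z * (1 + Y) * p - Y * (1 + Z) * q)"
    \<comment> \<open>For \<open>s = 1\<close> the value at \<open>a = -1/2\<close> is exactly 0, so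
      strictness must come from \<open>a > -1/2\<close>, that is, from \<open>r \<ge> 2\<close>. For
      odd \<open>s \<ge> 3\<close>, \<open>L\<close> itself is positive and \<open>r = 1\<close> is
      allowed.\<close>
    proof (cases "s = 1")
      case True
      then have r2: "r \<ge> 2" using rs by auto
      have "\<bar>a\<bar> \<le> 1/4"
        using power_decreasing[of 2 r "1/2::real"] r2 by (simp add: a_def power_abs power2_eq_square)
      then have "0 < a + 1/2" by linarith
      moreover have "L = 0"
      proof -
        have "z = 1 - y" using yz by simp
        then show ?thesis
          by (simp add: L_def Y_def Z_def p_def q_def True) (simp add: algebra_simps power2_eq_square)
      qed
      ultimately show ?thesis using coef by simp
    next
      case s1: False
      then have "s \<ge> 3" using False rs by (cases s; cases "s = 2") auto
      then obtain k where "s = k + 3" using le_iff_add[of 3 s] by (auto simp: add.commute)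
      then have "0 < L" using odd_extremal[OF yz, of k] by (simp add: L_def Y_def Z_def p_def q_def)
      moreover have "0 \<le> a + 1/2" using a by linarith
      ultimately show ?thesis using coef by (simp add: add_pos_nonneg)
    qed
    have "L / 2 + (a + 1/2) * (Z * (1 + Y) * p - Y * (1 + Z) * q)
        = (1 + Y) * (1 + a * Z) * p - (1 + Z) * (1 + a * Y) * q"
      by (simp add: L_def field_simps)
    with pos have "(1 + Z) * (1 + a * Y) * q < (1 + Y) * (1 + a * Z) * p" by linarith
    moreover have "0 < (1 + a * Y) * q" "0 < (1 + a * Z) * p"
      using sq aY aZ by (auto simp: p_def q_def intro!: mult_pos_pos)
    ultimately show ?thesis
      unfolding profit_kernel_def using False
      by (simp add: divide_less_cross mult.assoc flip: Y_def Z_def p_def q_def)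
  qed
qed

text \<open>After cancelling 1 + t, the kernel's denominator is (1 - t/2)(1 + t) = 1 + t(1 - t)/2,
  which is 1 + yz/2 at both points.\<close>

lemma profit_kernel_symmetric:
  fixes y z :: real
  assumes "y + z = 1" "0 < y" "0 < z"
  shows "profit_kernel (-1/2) 1 y = profit_kernel (-1/2) 1 z"
proof -
  have y: "y = 1 - z" using assms by simp
  have "(1 - y / 2) * (1 + y) = (1 - z / 2) * (1 + z)" unfolding y by (simp add: field_simps)
  then show ?thesis
    using assms by (simp add: profit_kernel_def power2_eq_square)
qed

section \<open>Eigenvalues and the sign of the mean profit\<close>

lemma eigenvalues_exist:
  fixes \<rho> :: real
  assumes "0 < \<rho>" "\<rho> \<noteq> 1"
  obtains y z where "y + z = 1" "y * z = 2 * \<rho>\<^sup>2 / ((1 + \<rho>\<^sup>2) * (1 + \<rho>)\<^sup>2)" "0 < y" "y < z"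
proof -
  define D where "D = 2 * \<rho>\<^sup>2 / ((1 + \<rho>\<^sup>2) * (1 + \<rho>)\<^sup>2)"
  have pos: "0 < (1 + \<rho>\<^sup>2) * (1 + \<rho>)\<^sup>2" using assms by (simp add: add_pos_nonneg)
  then have D0: "0 < D" using assms by (simp add: D_def)
  \<comment> \<open>This is the discriminant 1 - 4D of x^2 - x + D, cleared of its denominator; it
    is positive away from \<open>\<rho> = 1\<close>.\<close>
  have "(1 + \<rho>\<^sup>2) * (1 + \<rho>)\<^sup>2 - 8 * \<rho>\<^sup>2 = (1 - \<rho>)\<^sup>2 * (1 + 4 * \<rho> + \<rho>\<^sup>2)"
    by (simp add: algebra_simps power2_eq_square)
  moreover have "0 < (1 - \<rho>)\<^sup>2 * (1 + 4 * \<rho> + \<rho>\<^sup>2)"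
    using assms by (intro mult_pos_pos add_pos_nonneg) auto
  ultimately have "8 * \<rho>\<^sup>2 < (1 + \<rho>\<^sup>2) * (1 + \<rho>)\<^sup>2" by linarith
  then have D1: "4 * D < 1" using pos by (simp add: D_def divide_simps)
  define x where "x = sqrt (1 - 4 * D)"
  have x: "0 < x" "x < 1" "x\<^sup>2 = 1 - 4 * D" using D0 D1 by (auto simp: x_def)
  have "(1 - x) / 2 * ((1 + x) / 2) = D"
    using x(3) by (simp add: field_simps power2_eq_square)
  then show ?thesis
    using that[of "(1 - x) / 2" "(1 + x) / 2"] x D_def by (simp add: field_simps)
qed

text \<open>At \<open>\<rho> = 1\<close> the two eigenvalues coincide and the profit formula does
  not apply, but game B is then game A.\<close>

lemma mean_profit_one: "mean_profit 1 r s = 0"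
proof -
  have "game_B 1 = game_A" by (simp add: game_B_def game_A_def)
  then show ?thesis by (simp add: mean_profit_def Let_def expected_payoff_game_A)
qed

lemma mean_profit_sign:
  assumes "0 < \<rho>" "\<rho> \<noteq> 1" "0 < r" "0 < s" "\<not> (r = 1 \<and> s = 1)"
  obtains K where "0 < K" "mean_profit \<rho> r s = (1 - \<rho>) ^ 3 * K"
proof -
  obtain y z where yz: "y + z = 1" "y * z = 2 * \<rho>\<^sup>2 / ((1 + \<rho>\<^sup>2) * (1 + \<rho>)\<^sup>2)" "0 < y" "y < z"
    using eigenvalues_exist[OF assms(1,2)] .
  have "\<bar>(-1/2 :: real) ^ r\<bar> < 1" using assms(3) by (simp add: power_abs power_less_one_iff)
  then have "0 < 1 - (-1/2 :: real) ^ r" by linarith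
  moreover have "0 < 1 + \<rho>\<^sup>2" by (simp add: add_pos_nonneg)
  ultimately show ?thesis
    using profit_kernel_less[OF yz(1,3,4) assms(3-5)] assms yz
    by (intro that[OF _ mean_profit_formula[OF assms(1,3) yz]] mult_pos_pos divide_pos_pos) auto
qed

theorem theorem7:
  shows "(\<forall>r s :: nat. r > 0 \<and> s > 0 \<and> \<not> (r = 1 \<and> s = 1) \<longrightarrow>
            (\<forall>\<rho>::real. 0 < \<rho> \<and> \<rho> < 1 \<longrightarrow> mean_profit \<rho> r s > 0) \<and>
            mean_profit 1 r s = 0 \<and>
            (\<forall>\<rho>::real. \<rho> > 1 \<longrightarrow> mean_profit \<rho> r s < 0))
         \<and> (\<forall>\<rho>::real. \<rho> > 0 \<longrightarrow> mean_profit \<rho> 1 1 = 0)"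
proof (intro conjI allI impI)
  fix r s :: nat and \<rho> :: real
  assume rs: "r > 0 \<and> s > 0 \<and> \<not> (r = 1 \<and> s = 1)"
  show "mean_profit 1 r s = 0" by (rule mean_profit_one)
  show "mean_profit \<rho> r s > 0" if \<rho>: "0 < \<rho> \<and> \<rho> < 1"
  proof -
    obtain K where "0 < K" "mean_profit \<rho> r s = (1 - \<rho>) ^ 3 * K"
      using mean_profit_sign[of \<rho> r s] rs \<rho> by auto
    then show ?thesis using \<rho> by simp
  qed
  show "mean_profit \<rho> r s < 0" if \<rho>: "\<rho> > 1"
  proof -
    obtain K where "0 < K" "mean_profit \<rho> r s = (1 - \<rho>) ^ 3 * K"
      using mean_profit_sign[of \<rho> r s] rs \<rho> by auto
    moreover have "(1 - \<rho>) ^ 3 < 0" using \<rho> by (simp add: power_less_zero_eq)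
    ultimately show ?thesis by (simp add: mult_neg_pos)
  qed
next
  fix \<rho> :: real
  assume \<rho>: "\<rho> > 0"
  show "mean_profit \<rho> 1 1 = 0"
  proof (cases "\<rho> = 1")
    case True
    then show ?thesis by (simp only: mean_profit_one)
  next
    case False
    obtain y z where yz: "y + z = 1" "y * z = 2 * \<rho>\<^sup>2 / ((1 + \<rho>\<^sup>2) * (1 + \<rho>)\<^sup>2)" "0 < y" "y < z"
      using eigenvalues_exist[OF \<rho> False] .
    then show ?thesis
      using mean_profit_formula[OF \<rho> _ yz, of 1 1] profit_kernel_symmetric[OF yz(1)] by simp
  qed
qed

end
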